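(* For every $n\ge 1$, the map $\Psi$ is a bijection from the set of EW-tableaux of size $n$ to the set of permutations of $\{1,\dots,n\}$.
   Context: A Ferrers diagram is a left-aligned array of cells whose row lengths weakly decrease from top to bottom (here all rows are nonempty). An EW-tableau is a 0/1-filling of a Ferrers diagram such that (1) the top row has a 1 in every cell; (2) every other row has at least one cell containing a 0; (3) no four cells that form the corners of a rectangle have 0s in two diagonally opposite corners and 1s in the other two. Its size is (number of rows) + (number of columns) $-1$. Labels: for an EW-tableau of size $n$, traverse the southeast border from the northeast corner to the southwest corner and number its unit steps $0,1,\dots,n$; the vertical step at the right end of a row is the label of that row and the horizontal step at the bottom of a column is the label of that column. The top row has label $0$. The map $\Psi$ from EW-tableaux of size $n$ to permutations of $\{1,\dots,n\}$: delete all entries of the top row and disregard the label 0. Then repeat the following two steps until all labels have been read (equivalently, all entries deleted): (i) write down the labels of all unread columns containing no 1s, one after the other from right to left (i.e. in increasing order), and delete the entries of these columns; (ii) write down the labels of all unread rows containing no 0s, one after the other from bottom to top (i.e. in decreasing order), and delete the entries of these rows. The resulting word is $\Psi(\mathcal{T})$. *)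

theory Defs
  imports "HOL-Library.While_Combinator" "HOL-Combinatorics.Multiset_Permutations"
begin

text \<open>
  A filled left-aligned array is the list of its rows, from top to bottom, each row being the list
  of its entries from left to right. Rows and columns are indexed from 0, so the top row has index 0
  and the leftmost column has index 0; \<open>T ! i ! j\<close> is the entry in row \<open>i\<close> and column \<open>j\<close>.
\<close>

type_synonym filling = "nat list list"

definition ferrers_shape :: "filling \<Rightarrow> bool" where
  "ferrers_shape T \<longleftrightarrow>
     T \<noteq> [] \<and> (\<forall>r \<in> set T. r \<noteq> []) \<and> sorted_wrt (\<lambda>r s. length s \<le> length r) T"

definition cells :: "filling \<Rightarrow> (nat \<times> nat) set" where
  "cells T = {(i, j). i < length T \<and> j < length (T ! i)}"

definition ew_tableau :: "filling \<Rightarrow> bool" where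
  "ew_tableau T \<longleftrightarrow>
     ferrers_shape T \<and>
     (\<forall>(i, j) \<in> cells T. T ! i ! j \<in> {0, 1}) \<and>
     (\<forall>j. (0, j) \<in> cells T \<longrightarrow> T ! 0 ! j = 1) \<and>
     (\<forall>i. 0 < i \<and> i < length T \<longrightarrow> (\<exists>j. (i, j) \<in> cells T \<and> T ! i ! j = 0)) \<and>
     \<not> (\<exists>i i' j j'. i \<noteq> i' \<and> j \<noteq> j' \<and>
          (i, j) \<in> cells T \<and> (i, j') \<in> cells T \<and> (i', j) \<in> cells T \<and> (i', j') \<in> cells T \<and>
          T ! i ! j = 0 \<and> T ! i' ! j' = 0 \<and> T ! i ! j' = 1 \<and> T ! i' ! j = 1)"

text \<open>The number of columns is the length of the top row.\<close>

definition tableau_size :: "filling \<Rightarrow> nat" where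
  "tableau_size T = length T + length (hd T) - 1"

definition EW_tableaux :: "nat \<Rightarrow> filling set" where
  "EW_tableaux n = {T. ew_tableau T \<and> tableau_size T = n}"

datatype line = Row nat | Col nat

text \<open>
  The steps of the southeast border from the northeast to the southwest corner: the vertical step
  at the right end of a row, followed by the horizontal steps at the bottom of those columns which
  end in that row, from right to left. Each step is recorded as the row or column it belongs to, so
  \<open>border T ! k\<close> is the row or column with label \<open>k\<close>.
\<close>

definition border :: "filling \<Rightarrow> line list" where
  "border T = concat (map (\<lambda>i.
       Row i # map Col (rev [(if Suc i < length T then length (T ! Suc i) else 0)..<length (T ! i)]))
     [0..<length T])"

text \<open>
  A state \<open>(U, D, w)\<close> of the reading procedure consists of the labels not yet read, the cells
  whose entries have not been deleted, and the word written so far.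
\<close>

type_synonym reading_state = "nat set \<times> (nat \<times> nat) set \<times> nat list"

definition read_columns :: "filling \<Rightarrow> reading_state \<Rightarrow> reading_state" where
  "read_columns T = (\<lambda>(U, D, w).
     let L = {k \<in> U. \<exists>j. border T ! k = Col j \<and> \<not> (\<exists>i. (i, j) \<in> D \<and> T ! i ! j = 1)}
     in (U - L, D - {(i, j). Col j \<in> (\<lambda>k. border T ! k) ` L}, w @ sorted_list_of_set L))"

definition read_rows :: "filling \<Rightarrow> reading_state \<Rightarrow> reading_state" where
  "read_rows T = (\<lambda>(U, D, w).
     let L = {k \<in> U. \<exists>i. border T ! k = Row i \<and> \<not> (\<exists>j. (i, j) \<in> D \<and> T ! i ! j = 0)}
     in (U - L, D - {(i, j). Row i \<in> (\<lambda>k. border T ! k) ` L}, w @ rev (sorted_list_of_set L)))"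

definition Psi :: "filling \<Rightarrow> nat list" where
  "Psi T =
     (case while (\<lambda>(U, D, w). U \<noteq> {}) (\<lambda>s. read_rows T (read_columns T s))
             ({1..tableau_size T}, {(i, j) \<in> cells T. i \<noteq> 0}, [])
      of (U, D, w) \<Rightarrow> w)"

end

theory Submission imports Defs begin

text \<open>
  A row meets a column exactly when its label is smaller, so everything can be said in terms of
  labels, with the sets \<open>R\<close> of row labels and the remaining column labels.

  Consider the word written for a tableau. When a column \<open>c\<close> is read, it has a 0 in every
  unread row that it meets; when a row \<open>r\<close> is read, it has a 1 in every unread column. So the entry at
  \<open>(r, c)\<close> is 0 if and only if \<open>c\<close> precedes \<open>r\<close> in the word (\<open>legal_word_iff_position\<close>). Moreover,
  a row that becomes ready in some round has a 0 in a column read just before, so its label is smaller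
  than the largest, last written label of that batch of columns; dually for columns. Batches of
  columns are increasing and batches of rows decreasing. Hence the first letter is a column, and any
  other letter is a row if and only if it is smaller than its predecessor (\<open>Psi_progress\<close>). The
  procedure cannot get stuck, because rows that all have a 0 and columns that all have a 1 would
  produce a forbidden rectangle (\<open>ready_line_exists\<close>).

  The word thus reveals the row labels, hence the shape, and the order of each row and column, hence
  the entries: \<open>Psi\<close> is injective. Conversely, a permutation \<open>w\<close> prescribes a filling whose rows are
  0 and the descent bottoms and whose entries are given by relative positions in \<open>w\<close>. A forbidden
  rectangle would be a cycle in the linear order of positions, and each row has a 0 in the column that
  starts its descending run, so this is an EW-tableau. Its word and \<open>w\<close> have the same row letters, both
  at the descents, and both agree with the entries. Two such words are equal
  (\<open>legal_word_unique\<close>): at the first difference, a letter that one word delays is delayed only within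
  a monotone run, whose order is fixed, since otherwise the words would disagree about an entry.
\<close>

section \<open>Words in which every letter is ready when written\<close>

text \<open>
  Labels take the place of rows and columns here: \<open>R\<close> is the set of row labels, every other label is
  a column, and \<open>Z r c\<close> says that row \<open>r\<close> and column \<open>c\<close> meet in a 0. On the southeast border a row
  and a column share a cell exactly when the row comes first, which is why only pairs with \<open>r < c\<close>
  matter. A label is ready when the reading procedure may write it down while the labels in \<open>U\<close> are
  still unread.
\<close>

definition ready :: "nat set \<Rightarrow> (nat \<Rightarrow> nat \<Rightarrow> bool) \<Rightarrow> nat set \<Rightarrow> nat \<Rightarrow> bool" where
  "ready R Z U x \<longleftrightarrow>
     (if x \<in> R then \<forall>c \<in> U - R. x < c \<longrightarrow> \<not> Z x c else \<forall>r \<in> U \<inter> R. r < x \<longrightarrow> Z r x)"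

definition legal_word :: "nat set \<Rightarrow> (nat \<Rightarrow> nat \<Rightarrow> bool) \<Rightarrow> nat set \<Rightarrow> nat list \<Rightarrow> bool" where
  "legal_word R Z V w \<longleftrightarrow> (\<forall>us x vs. w = us @ x # vs \<longrightarrow> ready R Z (V - set us) x)"

text \<open>
  Runs of columns are written in increasing order and runs of rows in decreasing order; the condition
  says in addition that every change from columns to rows is a descent and every change back is an
  ascent. Hence the kind of each label can be recovered from the word.
\<close>

definition rows_at_descents :: "nat set \<Rightarrow> nat list \<Rightarrow> bool" where
  "rows_at_descents R w \<longleftrightarrow>
     (w \<noteq> [] \<longrightarrow> hd w \<notin> R) \<and> successively (\<lambda>x y. y \<in> R \<longleftrightarrow> y < x) w"

text \<open>
  A batch of labels is selected before any of its entries are deleted; since readiness persists,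
  writing the batch letter by letter is still legal.
\<close>

lemma ready_antimono: "ready R Z U x \<Longrightarrow> U' \<subseteq> U \<Longrightarrow> ready R Z U' x"
  by (auto simp: ready_def split: if_splits)

lemma legal_word_append:
  assumes "legal_word R Z V w" and "\<And>x. x \<in> set zs \<Longrightarrow> ready R Z (V - set w) x"
  shows "legal_word R Z V (w @ zs)"
  unfolding legal_word_def
proof (intro allI impI)
  fix us x vs assume eq: "w @ zs = us @ x # vs"
  then consider vs' where "w = us @ x # vs'" | us' where "us = w @ us'" "zs = us' @ x # vs"
    by (auto simp: append_eq_append_conv2 append_eq_Cons_conv)
  then show "ready R Z (V - set us) x"
  proof cases
    case 1
    then show ?thesis using assms(1) by (auto simp: legal_word_def)
  next
    case 2
    have "ready R Z (V - set w) x" using assms(2) 2 by auto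
    then show ?thesis by (rule ready_antimono) (auto simp: 2)
  qed
qed

lemma rows_at_descents_append:
  assumes "rows_at_descents R w" "zs \<noteq> []"
    and "successively (\<lambda>x y. y \<in> R \<longleftrightarrow> y < x) zs"
    and "if w = [] then hd zs \<notin> R else hd zs \<in> R \<longleftrightarrow> hd zs < last w"
  shows "rows_at_descents R (w @ zs)"
  using assms by (auto simp: rows_at_descents_def successively_append_iff split: if_splits)

text \<open>
  Walking left from a row letter \<open>x\<close>, the letters grow as long as they are rows, and the first column
  met is larger than \<open>x\<close> as well. So either that column is reached before \<open>y\<close>, or all letters from \<open>y\<close>
  to \<open>x\<close> belong to one decreasing run of rows. The next lemma is the mirror image for columns.
\<close>

lemma row_after_larger_column:
  fixes R :: "nat set"
  assumes "successively (\<lambda>x y. y \<in> R \<longleftrightarrow> y < x) (y # as @ [x])" "x \<in> R"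
  shows "(\<exists>c \<in> set (y # as) - R. x < c) \<or> y \<in> R \<and> x < y"
  using assms
proof (induction as arbitrary: x rule: rev_induct)
  case Nil
  then show ?case by (auto simp: successively_Cons)
next
  case (snoc z as)
  have *: "successively (\<lambda>x y. y \<in> R \<longleftrightarrow> y < x) (y # as @ [z])" "z > x"
    using snoc.prems successively_append_iff[of _ "y # as @ [z]" "[x]"] by auto
  show ?case
  proof (cases "z \<in> R")
    case True
    from snoc.IH[OF *(1) True] *(2) show ?thesis by (auto intro: less_trans)
  next
    case False
    then show ?thesis using *(2) by auto
  qed
qed

lemma column_after_smaller_row:
  fixes R :: "nat set"
  assumes "successively (\<lambda>x y. y \<in> R \<longleftrightarrow> y < x) (y # as @ [x])" "x \<notin> R" "distinct (y # as @ [x])"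
  shows "(\<exists>r \<in> set (y # as) \<inter> R. r < x) \<or> y \<notin> R \<and> y < x"
  using assms
proof (induction as arbitrary: x rule: rev_induct)
  case Nil
  then show ?case by (cases "y \<in> R") (auto simp: successively_Cons)
next
  case (snoc z as)
  have *: "successively (\<lambda>x y. y \<in> R \<longleftrightarrow> y < x) (y # as @ [z])" "z < x"
    using snoc.prems successively_append_iff[of _ "y # as @ [z]" "[x]"] by auto
  show ?case
  proof (cases "z \<in> R")
    case True
    then show ?thesis using *(2) by auto
  next
    case False
    have "distinct (y # as @ [z])" using snoc.prems(3) by auto
    from snoc.IH[OF *(1) False this] *(2) show ?thesis by (auto intro: less_trans)
  qed
qed

text \<open>
  Two words agree on the prefix \<open>us\<close>; the first then has \<open>x\<close>, the second \<open>y\<close> and only later \<open>x\<close>. Suppose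
  that, in the second word, some line \<open>u\<close> of the kind opposite to \<open>x\<close> and meeting \<open>x\<close> stands between
  the common prefix and \<open>x\<close>. In the first word \<open>x\<close> is written before \<open>u\<close> and in the second after it, so
  the two words demand different entries in the cell where \<open>x\<close> and \<open>u\<close> meet. Therefore \<open>x\<close> lies in
  the same monotone run of the second word as \<open>y\<close>.
\<close>

lemma first_difference:
  assumes w: "legal_word R Z V w" "w = us @ x # ws"
    and v: "legal_word R Z V v" "rows_at_descents R v" "distinct v" "set v \<subseteq> V" "v = us @ y # vs"
    and x: "x \<in> set vs"
  shows "(x \<in> R \<longleftrightarrow> y \<in> R) \<and> (if x \<in> R then x < y else y < x)"
proof -
  obtain as bs where vs: "vs = as @ x # bs" using x by (meson split_list)
  have rx: "ready R Z (V - set us) x" using w by (auto simp: legal_word_def)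
  have "successively (\<lambda>x y. y \<in> R \<longleftrightarrow> y < x) (us @ (y # as @ [x]) @ bs)"
    using v vs by (auto simp: rows_at_descents_def)
  then have s: "successively (\<lambda>x y. y \<in> R \<longleftrightarrow> y < x) (y # as @ [x])"
    by (simp only: successively_append_iff)
  have d: "distinct (y # as @ [x])" using v vs by auto
  have unread: "\<exists>us'. ready R Z (V - set us') z \<and> x \<in> V - set us' \<and> z \<in> V - set us"
    if z: "z \<in> set (y # as)" for z
  proof -
    obtain cs ds where cd: "y # as = cs @ z # ds" using z by (meson split_list)
    have e: "v = us @ (cs @ z # ds) @ x # bs" unfolding cd[symmetric] using v(5) vs by simp
    then have "v = (us @ cs) @ z # ds @ x # bs" by simp
    then have "ready R Z (V - set (us @ cs)) z" using v(1) unfolding legal_word_def by blast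
    moreover have "x \<in> V - set (us @ cs) \<and> z \<in> V - set us" using e v(3,4) by auto
    ultimately show ?thesis by blast
  qed
  show ?thesis
  proof (cases "x \<in> R")
    case True
    show ?thesis
    proof (rule ccontr)
      assume "\<not> ?thesis"
      then obtain c where c: "c \<in> set (y # as)" "c \<notin> R" "x < c"
        using row_after_larger_column[OF s True] True by auto
      obtain us' where "ready R Z (V - set us') c" "x \<in> V - set us'" "c \<in> V - set us"
        using unread[OF c(1)] by blast
      then show False using rx c True by (auto simp: ready_def)
    qed
  next
    case False
    show ?thesis
    proof (rule ccontr)
      assume "\<not> ?thesis"
      then obtain r where r: "r \<in> set (y # as)" "r \<in> R" "r < x"
        using column_after_smaller_row[OF s False d] False by auto
      obtain us' where "ready R Z (V - set us') r" "x \<in> V - set us'" "r \<in> V - set us"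
        using unread[OF r(1)] by blast
      then show False using rx r False by (auto simp: ready_def)
    qed
  qed
qed

text \<open>
  At the first difference the preceding lemma applies in both directions: the two letters are of the
  same kind, and each would have to come before the other in the monotone order of their common run.
\<close>

lemma legal_word_unique:
  assumes w: "legal_word R Z V w" "rows_at_descents R w" "distinct w" "set w = V"
    and v: "legal_word R Z V v" "rows_at_descents R v" "distinct v" "set v = V"
  shows "w = v"
proof (rule ccontr)
  assume "w \<noteq> v"
  moreover have "length w = length v" using w v by (metis distinct_card)
  ultimately obtain us x ws y vs where d: "x \<noteq> y" "w = us @ x # ws" "v = us @ y # vs"
    using same_length_different[of w v] by (metis append_Cons append_Nil)
  have "x \<in> set v" "y \<in> set w" using w(4) v(4) d by auto
  then have "x \<in> set vs" "y \<in> set ws" using d w(3) v(3) by auto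
  from first_difference[OF w(1) d(2) v(1-3) _ d(3) this(1)] first_difference[OF v(1) d(3) w(1-3) _ d(2) this(2)]
  show False using w(4) v(4) by (auto split: if_splits)
qed

section \<open>Entries as relative positions\<close>

definition position :: "nat list \<Rightarrow> nat \<Rightarrow> nat" where
  "position w x = length (takeWhile (\<lambda>y. y \<noteq> x) w)"

lemma nth_position:
  assumes "x \<in> set w"
  shows "w ! position w x = x"
proof -
  obtain us vs where w: "w = us @ x # vs" "x \<notin> set us" using assms by (meson split_list_first)
  have "position w x = length us"
    unfolding position_def w(1) using w(2) by (subst takeWhile_append2) auto
  then show ?thesis using w by simp
qed

lemma position_less_iff:
  assumes "distinct (us @ x # vs)"
  shows "position (us @ x # vs) y < position (us @ x # vs) x \<longleftrightarrow> y \<in> set us"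
proof -
  have "position (us @ x # vs) x = length us"
    using assms unfolding position_def by (subst takeWhile_append2) auto
  moreover have "position (us @ x # vs) y < length us \<longleftrightarrow> y \<in> set us"
  proof (cases "y \<in> set us")
    case True
    then have "position (us @ x # vs) y = length (takeWhile (\<lambda>z. z \<noteq> y) us)"
      unfolding position_def by (subst takeWhile_append1[of y]) auto
    moreover have "takeWhile (\<lambda>z. z \<noteq> y) us \<noteq> us"
      using True by (auto simp: takeWhile_eq_all_conv)
    then have "length (takeWhile (\<lambda>z. z \<noteq> y) us) < length us"
      using length_takeWhile_le[of "\<lambda>z. z \<noteq> y" us] takeWhile_eq_take[of "\<lambda>z. z \<noteq> y" us]
      by (metis order_le_imp_less_or_eq take_all_iff order_refl)
    ultimately show ?thesis using True by simp
  next
    case False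
    then show ?thesis unfolding position_def by (subst takeWhile_append2) auto
  qed
  ultimately show ?thesis by simp
qed

text \<open>
  The reason that a filling and its word determine each other: whichever of a row and a column is
  written first is ready while the other is still unread, which forces their common entry, to be 0 if
  the column comes first and 1 if the row does.
\<close>

lemma legal_word_iff_position:
  assumes "distinct w" "set w = V"
  shows "legal_word R Z V w \<longleftrightarrow>
    (\<forall>r \<in> V \<inter> R. \<forall>c \<in> V - R. r < c \<longrightarrow> (Z r c \<longleftrightarrow> position w c < position w r))" (is "?l = ?r")
proof
  assume l: ?l
  show ?r
  proof (intro ballI impI iffI)
    fix r c assume rc: "r \<in> V \<inter> R" "c \<in> V - R" "r < c"
    obtain us vs where w: "w = us @ r # vs" using rc assms(2) split_list[of r w] by blast
    { assume "Z r c"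
      have "ready R Z (V - set us) r" using l w by (auto simp: legal_word_def)
      then have "c \<in> set us" using rc \<open>Z r c\<close> by (auto simp: ready_def)
      then show "position w c < position w r" using w assms(1) position_less_iff by auto }
    { assume p: "position w c < position w r"
      obtain us vs where w: "w = us @ c # vs" using rc assms(2) split_list[of c w] by blast
      have "r \<notin> set us" using w p assms(1) position_less_iff[of us c vs r] by auto
      moreover have "ready R Z (V - set us) c" using l w by (auto simp: legal_word_def)
      ultimately show "Z r c" using rc by (auto simp: ready_def) }
  qed
next
  assume r: ?r
  show ?l unfolding legal_word_def
  proof (intro allI impI)
    fix us x vs assume w: "w = us @ x # vs"
    have d: "distinct (us @ x # vs)" using assms w by simp
    have pos: "position w y > position w x" if y: "y \<in> V - set us" "y \<noteq> x" for y
    proof -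
      obtain as bs where ab: "w = as @ y # bs" using y assms(2) split_list[of y w] by blast
      have "\<not> position w y < position w x" using that position_less_iff[OF d] w by auto
      moreover have "position w y \<noteq> position w x"
        using that nth_position[of x w] nth_position[of y w] assms(2) w
        by (metis DiffD1 in_set_conv_decomp)
      ultimately show ?thesis by simp
    qed
    have xV: "x \<in> V" using w assms by auto
    show "ready R Z (V - set us) x"
    proof (cases "x \<in> R")
      case True
      have "\<not> Z x c" if "c \<in> V - set us - R" "x < c" for c
        using pos[of c] r[rule_format, of x c] that True xV by auto
      then show ?thesis using True by (simp add: ready_def)
    next
      case False
      have "Z r x" if "r \<in> (V - set us) \<inter> R" "r < x" for r
        using pos[of r] r[rule_format, of r x] that False xV by auto
      then show ?thesis using False by (simp add: ready_def)
    qed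
  qed
qed

section \<open>One round of the reading procedure\<close>

definition no_bad_rectangle :: "nat set \<Rightarrow> (nat \<Rightarrow> nat \<Rightarrow> bool) \<Rightarrow> nat set \<Rightarrow> bool" where
  "no_bad_rectangle R Z V \<longleftrightarrow> (\<forall>r \<in> V \<inter> R. \<forall>r' \<in> V \<inter> R. \<forall>c \<in> V - R. \<forall>c' \<in> V - R.
     r < c \<and> r < c' \<and> r' < c \<and> r' < c' \<and> Z r c \<and> Z r' c' \<longrightarrow> Z r c' \<or> Z r' c)"

text \<open>
  This is why the procedure never gets stuck. The induction removes the bottom row \<open>r\<close>, that is, the
  row with the largest label. Suppose nothing is ready. Any label that becomes ready through the
  removal of \<open>r\<close> is a column \<open>x\<close> whose only 1 is in row \<open>r\<close>. Row \<open>r\<close> has a 0 in some column \<open>c\<close>, and \<open>c\<close>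
  has a 1 in some row \<open>r'\<close> above \<open>r\<close>. Because \<open>r'\<close> lies higher, it also meets \<open>x\<close>, in a 0. The rows \<open>r\<close>,
  \<open>r'\<close> and the columns \<open>c\<close>, \<open>x\<close> then form a forbidden rectangle.
\<close>

lemma ready_line_exists:
  assumes "finite U" "U \<noteq> {}" "no_bad_rectangle R Z U"
  shows "\<exists>x \<in> U. ready R Z U x"
proof -
  have "\<exists>x \<in> U. ready R Z U x" if "finite A" "A = U \<inter> R" for A
    using that(1) that(2) assms
  proof (induction A arbitrary: U rule: finite_linorder_max_induct)
    case empty
    then show ?case by (auto simp: ready_def)
  next
    case (insert r A)
    show ?case
    proof (rule ccontr)
      assume stuck: "\<not> ?thesis"
      have eq: "U \<inter> R = insert r A" using insert.prems(1) by simp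
      have rU: "r \<in> U" "r \<in> R" using eq by auto
      have "\<not> ready R Z U r" using stuck rU by blast
      then obtain c where c: "c \<in> U - R" "r < c" "Z r c"
        using rU by (auto simp: ready_def)
      have "r \<notin> A" using insert.hyps(2) by auto
      then have A: "A = (U - {r}) \<inter> R" using eq by blast
      have "no_bad_rectangle R Z (U - {r})"
        using insert.prems(4) unfolding no_bad_rectangle_def by blast
      moreover have "U - {r} \<noteq> {}" using c rU by auto
      ultimately obtain x where x: "x \<in> U - {r}" "ready R Z (U - {r}) x"
        using insert.IH[OF A] insert.prems(2) by auto
      show False
      proof (cases "x \<in> R")
        case True
        have "\<not> ready R Z U x" using stuck x by auto
        then show False using x True rU by (auto simp: ready_def)
      next
        case False
        have "\<not> ready R Z U x" using stuck x by auto
        then have xr: "r < x" "\<not> Z r x" using x False by (auto simp: ready_def)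
        have "\<not> ready R Z U c" using stuck c by blast
        then obtain r' where r': "r' \<in> U \<inter> R" "r' < c" "\<not> Z r' c"
          using c by (auto simp: ready_def)
        have "r' \<in> insert r A" using r'(1) eq by simp
        moreover have "r' \<noteq> r" using r' c by auto
        ultimately have "r' < r" using insert.hyps(2) by auto
        moreover have "Z r' x" using x(2) False r' calculation xr by (auto simp: ready_def)
        ultimately show False
          using insert.prems(4)[unfolded no_bad_rectangle_def, rule_format, of r r' c x] r' rU c x(1) xr False
          by auto
      qed
    qed
  qed
  then show ?thesis using assms by blast
qed

definition ready_columns :: "nat set \<Rightarrow> (nat \<Rightarrow> nat \<Rightarrow> bool) \<Rightarrow> nat set \<Rightarrow> nat set" where
  "ready_columns R Z U = {c \<in> U - R. ready R Z U c}"

definition ready_rows :: "nat set \<Rightarrow> (nat \<Rightarrow> nat \<Rightarrow> bool) \<Rightarrow> nat set \<Rightarrow> nat set" where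
  "ready_rows R Z U = {r \<in> U \<inter> R. ready R Z U r}"

definition progress :: "nat set \<Rightarrow> (nat \<Rightarrow> nat \<Rightarrow> bool) \<Rightarrow> nat set \<Rightarrow> nat set \<Rightarrow> nat list \<Rightarrow> bool" where
  "progress R Z V U w \<longleftrightarrow>
     U \<subseteq> V \<and> set w = V - U \<and> distinct w \<and> legal_word R Z V w \<and> rows_at_descents R w"

text \<open>
  The two invariants, one before each half of a round. The conditions on \<open>last w\<close> make the next batch
  continue the word with an ascent to a column or a descent to a row, as \<^const>\<open>rows_at_descents\<close>
  requires.
\<close>

definition before_columns where
  "before_columns R Z V U w \<longleftrightarrow> progress R Z V U w \<and> ready_rows R Z U = {} \<and>
     (w \<noteq> [] \<longrightarrow> (\<forall>c \<in> ready_columns R Z U. last w < c))"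

definition before_rows where
  "before_rows R Z V U w \<longleftrightarrow> progress R Z V U w \<and> ready_columns R Z U = {} \<and>
     w \<noteq> [] \<and> (\<forall>r \<in> ready_rows R Z U. r < last w)"

lemma last_sorted_list_of_set:
  fixes A :: "nat set"
  assumes "finite A" "x \<in> A"
  shows "x \<le> last (sorted_list_of_set A)"
proof -
  let ?l = "sorted_list_of_set A"
  have "x \<in> set ?l" using assms by simp
  then have "?l \<noteq> []" by force
  obtain i where i: "i < length ?l" "?l ! i = x" using \<open>x \<in> set ?l\<close> by (auto simp only: in_set_conv_nth)
  have "?l ! i \<le> ?l ! (length ?l - 1)" using i by (intro sorted_nth_mono) auto
  then show ?thesis using i last_conv_nth[OF \<open>?l \<noteq> []\<close>] by simp
qed

lemma progress_columns:
  assumes p: "progress R Z V U w" "finite V" and L: "L = ready_columns R Z U" "L \<noteq> {}"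
    and last: "w \<noteq> [] \<Longrightarrow> \<forall>c \<in> L. last w < c"
  shows "progress R Z V (U - L) (w @ sorted_list_of_set L)"
proof -
  let ?zs = "sorted_list_of_set L"
  have U: "U = V - set w" "finite U" using p by (auto simp: progress_def intro: finite_subset)
  have LU: "L \<subseteq> U - R" "finite L" using L(1) U(2) by (auto simp: ready_columns_def)
  have s: "sorted_wrt (<) ?zs" "?zs \<noteq> []" "set ?zs = L" using LU L(2) by auto
  have "successively (\<lambda>x y. y \<in> R \<longleftrightarrow> y < x) ?zs"
    using LU s(3) by (intro successively_mono[OF successively_if_sorted_wrt[OF s(1)]]) auto
  moreover have "hd ?zs \<in> L" using s by (metis list.set_sel(1))
  ultimately have "rows_at_descents R (w @ ?zs)"
    using p(1) s(2) LU last by (intro rows_at_descents_append) (force simp: progress_def)+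
  moreover have "legal_word R Z V (w @ ?zs)"
  proof (rule legal_word_append)
    fix x assume "x \<in> set ?zs"
    then have "x \<in> L" using s(3) by blast
    then show "ready R Z (V - set w) x"
      unfolding L(1) U(1)[symmetric] by (simp add: ready_columns_def)
  qed (use p(1) in \<open>simp add: progress_def\<close>)
  ultimately show ?thesis using p(1) LU s(3) by (auto simp: progress_def)
qed

lemma progress_rows:
  assumes p: "progress R Z V U w" "finite V" and L: "L = ready_rows R Z U"
    and last: "w \<noteq> []" "\<forall>r \<in> L. r < last w"
  shows "progress R Z V (U - L) (w @ rev (sorted_list_of_set L))"
proof (cases "L = {}")
  case True
  then show ?thesis using p by simp
next
  case False
  let ?zs = "rev (sorted_list_of_set L)"
  have U: "U = V - set w" "finite U" using p by (auto simp: progress_def intro: finite_subset)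
  have LU: "L \<subseteq> U \<inter> R" "finite L" using L(1) U(2) by (auto simp: ready_rows_def)
  have s: "sorted_wrt (>) ?zs" "?zs \<noteq> []" "set ?zs = L" using LU False by (auto simp: sorted_wrt_rev)
  have "successively (\<lambda>x y. y \<in> R \<longleftrightarrow> y < x) ?zs"
    using LU s(3) by (intro successively_mono[OF successively_if_sorted_wrt[OF s(1)]]) auto
  moreover have "hd ?zs \<in> L" using s by (metis list.set_sel(1))
  ultimately have "rows_at_descents R (w @ ?zs)"
    using p(1) s(2) LU last by (intro rows_at_descents_append) (auto simp: progress_def)
  moreover have "legal_word R Z V (w @ ?zs)"
  proof (rule legal_word_append)
    fix x assume "x \<in> set ?zs"
    then have "x \<in> L" using s(3) by blast
    then show "ready R Z (V - set w) x"
      unfolding L U(1)[symmetric] by (simp add: ready_rows_def)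
  qed (use p(1) in \<open>simp add: progress_def\<close>)
  ultimately show ?thesis using p(1) LU s(3) by (auto simp: progress_def)
qed

text \<open>
  Reading columns cannot make another column ready, and reading rows cannot make another row ready:
  after each half of a round no line of the kind just read is ready.
\<close>

lemma ready_column_cong: "c \<notin> R \<Longrightarrow> U \<inter> R = U' \<inter> R \<Longrightarrow> ready R Z U c \<longleftrightarrow> ready R Z U' c"
  and ready_row_cong: "r \<in> R \<Longrightarrow> U - R = U' - R \<Longrightarrow> ready R Z U r \<longleftrightarrow> ready R Z U' r"
  by (simp_all add: ready_def)

text \<open>
  A row that is ready after the columns \<open>L\<close> are read was not ready before, so it has a 0 in some column
  of \<open>L\<close>. The label of that column exceeds that of the row, and the last letter written is the largest
  label in \<open>L\<close>.
\<close>

lemma before_rows_step: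
  assumes b: "before_columns R Z V U w" and V: "finite V" "no_bad_rectangle R Z V"
    and "U \<noteq> {}" and L: "L = ready_columns R Z U"
  shows "before_rows R Z V (U - L) (w @ sorted_list_of_set L)" "L \<noteq> {}"
proof -
  have U: "U \<subseteq> V" "finite U" "progress R Z V U w"
    using b V(1) by (auto simp: before_columns_def progress_def intro: finite_subset)
  have "no_bad_rectangle R Z U" using V(2) U(1) unfolding no_bad_rectangle_def by blast
  then show ne: "L \<noteq> {}"
    using ready_line_exists[OF U(2) \<open>U \<noteq> {}\<close>, of R Z] b
    unfolding L before_columns_def ready_columns_def ready_rows_def by blast
  have fin: "finite L" using L U by (auto simp: ready_columns_def)
  have "progress R Z V (U - L) (w @ sorted_list_of_set L)"
    using progress_columns[OF U(3) V(1) L ne] b L by (auto simp: before_columns_def)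
  moreover have "ready_columns R Z (U - L) = {}"
    using ready_column_cong[of _ R "U - L" U] L unfolding ready_columns_def by blast
  moreover have "r < last (sorted_list_of_set L)" if r: "r \<in> ready_rows R Z (U - L)" for r
  proof -
    have "\<not> ready R Z U r" "r \<in> R" using r b by (auto simp: before_columns_def ready_rows_def)
    then obtain c where c: "c \<in> U - R" "r < c" "Z r c" by (auto simp: ready_def)
    then have "c \<in> L" using r by (auto simp: ready_rows_def ready_def)
    then show ?thesis using last_sorted_list_of_set[OF fin] c(2) by fastforce
  qed
  ultimately show "before_rows R Z V (U - L) (w @ sorted_list_of_set L)"
    using ne fin by (auto simp: before_rows_def)
qed

text \<open>
  Dually, a column that becomes ready has a 1 in one of the rows just read, whose label is smaller,
  and the last letter written is the smallest label of such a row.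
\<close>

lemma before_columns_step:
  assumes b: "before_rows R Z V U w" and V: "finite V" and L: "L = ready_rows R Z U"
  shows "before_columns R Z V (U - L) (w @ rev (sorted_list_of_set L))"
proof -
  have U: "U \<subseteq> V" "finite U" "progress R Z V U w"
    using b V(1) by (auto simp: before_rows_def progress_def intro: finite_subset)
  have fin: "finite L" using L U by (auto simp: ready_rows_def)
  have "progress R Z V (U - L) (w @ rev (sorted_list_of_set L))"
    using progress_rows[OF U(3) V(1) L] b L by (auto simp: before_rows_def)
  moreover have "ready_rows R Z (U - L) = {}"
    using ready_row_cong[of _ R "U - L" U] L unfolding ready_rows_def by blast
  moreover have "last (w @ rev (sorted_list_of_set L)) < c" if c: "c \<in> ready_columns R Z (U - L)" for c
  proof -
    have "\<not> ready R Z U c" "c \<notin> R" using c b by (auto simp: before_rows_def ready_columns_def)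
    then obtain r where r: "r \<in> U \<inter> R" "r < c" "\<not> Z r c" by (auto simp: ready_def)
    then have rL: "r \<in> L" using c by (auto simp: ready_columns_def ready_def)
    then have "hd (sorted_list_of_set L) = Min L"
      using fin sorted_list_of_set_nonempty[of L] by (metis empty_iff list.sel(1))
    moreover have "Min L \<le> r" "L \<noteq> {}" using rL fin by auto
    ultimately show ?thesis using fin r(2) by (simp add: last_rev)
  qed
  ultimately show ?thesis by (auto simp: before_columns_def)
qed

section \<open>Labels of the border\<close>

fun is_row :: "line \<Rightarrow> bool" where
  "is_row (Row i) = True"
| "is_row (Col j) = False"

text \<open>
  The order in which the border visits the lines, expressed by the shape alone.
\<close>

fun line_before :: "filling \<Rightarrow> line \<Rightarrow> line \<Rightarrow> bool" where
  "line_before T (Row i) (Row i') \<longleftrightarrow> i < i'"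
| "line_before T (Row i) (Col j) \<longleftrightarrow> j < length (T ! i)"
| "line_before T (Col j) (Row i) \<longleftrightarrow> length (T ! i) \<le> j"
| "line_before T (Col j) (Col j') \<longleftrightarrow> j' < j"

definition row_length :: "filling \<Rightarrow> nat \<Rightarrow> nat" where
  "row_length T i = (if i < length T then length (T ! i) else 0)"

lemma row_length_antimono:
  assumes "ferrers_shape T" "i \<le> i'"
  shows "row_length T i' \<le> row_length T i"
  using assms sorted_wrt_nth_less[of "\<lambda>r s. length s \<le> length r" T i i']
  by (cases "i = i'") (auto simp: row_length_def ferrers_shape_def)

text \<open>
  The part of the border that belongs to the first \<open>m\<close> rows.
\<close>

definition border_upto :: "filling \<Rightarrow> nat \<Rightarrow> line list" where
  "border_upto T m = concat (map (\<lambda>i.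
     Row i # map Col (rev [row_length T (Suc i)..<row_length T i])) [0..<m])"

lemma border_eq: "border T = border_upto T (length T)"
  unfolding border_def border_upto_def row_length_def
  by (intro arg_cong[where f = concat] map_cong) auto

lemma rev_upt_append: "a \<le> b \<Longrightarrow> b \<le> c \<Longrightarrow> rev [b..<c] @ rev [a..<b] = rev [a..<c]"
  using upt_add_eq_append[of a b "c - b"] by simp

lemma border_upto:
  assumes T: "ferrers_shape T" and m: "m \<le> length T"
  shows "filter is_row (border_upto T m) = map Row [0..<m]"
    and "filter (\<lambda>x. \<not> is_row x) (border_upto T m) = map Col (rev [row_length T m..<row_length T 0])"
    and "sorted_wrt (line_before T) (border_upto T m)"
proof -
  let ?set = "\<lambda>m. set (border_upto T m) \<subseteq> Row ` {..<m} \<union> Col ` {row_length T m..}"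
  have "filter is_row (border_upto T m) = map Row [0..<m] \<and>
    filter (\<lambda>x. \<not> is_row x) (border_upto T m) = map Col (rev [row_length T m..<row_length T 0]) \<and>
    sorted_wrt (line_before T) (border_upto T m) \<and> ?set m"
    using m
  proof (induction m)
    case 0
    then show ?case by (simp add: border_upto_def)
  next
    case (Suc m)
    let ?new = "Row m # map Col (rev [row_length T (Suc m)..<row_length T m])"
    have B: "border_upto T (Suc m) = border_upto T m @ ?new" by (simp add: border_upto_def)
    have le: "row_length T (Suc m) \<le> row_length T m" "row_length T m \<le> row_length T 0"
      using T by (auto intro: row_length_antimono)
    have len: "length (T ! i) \<ge> row_length T m" if "i \<le> m" for i
      using row_length_antimono[OF T that] that Suc.prems by (simp add: row_length_def)
    have m: "length (T ! m) = row_length T m" using Suc.prems by (simp add: row_length_def)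
    have IH: "filter is_row (border_upto T m) = map Row [0..<m]"
      "filter (\<lambda>x. \<not> is_row x) (border_upto T m) = map Col (rev [row_length T m..<row_length T 0])"
      "sorted_wrt (line_before T) (border_upto T m)" "?set m"
      using Suc by auto
    have cols: "filter is_row (map Col xs) = []" "filter (\<lambda>x. \<not> is_row x) (map Col xs) = map Col xs" for xs
      by (auto simp: filter_empty_conv)
    have F1: "filter is_row (border_upto T (Suc m)) = map Row [0..<Suc m]"
      unfolding B by (simp add: IH cols del: rev_map)
    have F2: "filter (\<lambda>x. \<not> is_row x) (border_upto T (Suc m)) =
        map Col (rev [row_length T (Suc m)..<row_length T 0])"
      unfolding B by (simp only: filter_append IH cols filter.simps is_row.simps simp_thms if_False if_True not_True_eq_False
           rev_upt_append[OF le, symmetric] map_append)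
    have "sorted_wrt (line_before T) ?new"
      using m by (auto simp: sorted_wrt_map sorted_wrt_rev simp flip: rev_map)
    moreover have "\<forall>x \<in> set (border_upto T m). \<forall>y \<in> set ?new. line_before T x y"
    proof (intro ballI)
      fix x y assume x: "x \<in> set (border_upto T m)" and y: "y \<in> set ?new"
      from x IH(4) consider i where "x = Row i" "i < m" | j where "x = Col j" "row_length T m \<le> j"
        by blast
      then show "line_before T x y"
      proof cases
        case 1
        then show ?thesis using y len[of i] by auto
      next
        case 2
        then show ?thesis using y m by auto
      qed
    qed
    ultimately have "sorted_wrt (line_before T) (border_upto T (Suc m))"
      unfolding B sorted_wrt_append using IH(3) by blast
    moreover have "?set (Suc m)"
    proof
      fix x assume "x \<in> set (border_upto T (Suc m))"
      then consider "x \<in> set (border_upto T m)" | "x = Row m" | j where "x = Col j" "row_length T (Suc m) \<le> j"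
        unfolding B by auto
      then show "x \<in> Row ` {..<Suc m} \<union> Col ` {row_length T (Suc m)..}"
        by cases (use IH(4) le(1) in \<open>force+\<close>)
    qed
    ultimately show ?case using F1 F2 by blast
  qed
  then show "filter is_row (border_upto T m) = map Row [0..<m]"
    and "filter (\<lambda>x. \<not> is_row x) (border_upto T m) = map Col (rev [row_length T m..<row_length T 0])"
    and "sorted_wrt (line_before T) (border_upto T m)" by auto
qed

text \<open>
  Rows occur on the border from top to bottom and columns from right to left, so the border is
  determined by the pattern of vertical and horizontal steps.
\<close>

lemma list_eq_if_same_rows_and_columns:
  assumes "map is_row b = map is_row b'" "filter is_row b = filter is_row b'"
    and "filter (\<lambda>x. \<not> is_row x) b = filter (\<lambda>x. \<not> is_row x) b'"
  shows "b = b'"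
proof -
  have "length b = length b'" using assms(1) by (rule map_eq_imp_length_eq)
  then show ?thesis using assms
    by (induction b b' rule: list_induct2) (auto split: if_splits)
qed

text \<open>
  The top row, with label 0, is left out, because its entries are deleted and its label disregarded
  before the reading starts.
\<close>

definition row_labels :: "filling \<Rightarrow> nat set" where
  "row_labels T = {k \<in> {1..tableau_size T}. is_row (border T ! k)}"

definition zero_entry :: "filling \<Rightarrow> nat \<Rightarrow> nat \<Rightarrow> bool" where
  "zero_entry T r c \<longleftrightarrow>
     (\<exists>i j. border T ! r = Row i \<and> border T ! c = Col j \<and> T ! i ! j = 0)"

text \<open>
  The cells whose row and column are both unread; these are the cells \<open>D\<close> of a reading state.
\<close>

definition live_cells :: "filling \<Rightarrow> nat set \<Rightarrow> (nat \<times> nat) set" where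
  "live_cells T U =
     {(i, j). \<exists>r \<in> U. \<exists>c \<in> U. r < c \<and> border T ! r = Row i \<and> border T ! c = Col j}"

locale ferrers =
  fixes T :: filling and n :: nat
  assumes shape: "ferrers_shape T" and size: "tableau_size T = n"
begin

lemma rows_of_border: "filter is_row (border T) = map Row [0..<length T]"
  and columns_of_border: "filter (\<lambda>x. \<not> is_row x) (border T) = map Col (rev [0..<length (hd T)])"
  and border_sorted: "sorted_wrt (line_before T) (border T)"
  using border_upto[OF shape order_refl] shape
  by (auto simp: border_eq row_length_def ferrers_shape_def hd_conv_nth)

lemma set_border: "set (border T) = Row ` {..<length T} \<union> Col ` {..<length (hd T)}"
proof -
  have "set (border T) = set (filter is_row (border T)) \<union> set (filter (\<lambda>x. \<not> is_row x) (border T))"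
    by auto
  also have "\<dots> = Row ` {..<length T} \<union> Col ` {..<length (hd T)}"
    unfolding rows_of_border columns_of_border by auto
  finally show ?thesis .
qed

lemma length_border: "length (border T) = Suc n"
proof -
  have "length (border T) = length T + length (hd T)"
    using sum_length_filter_compl[of is_row "border T"]
    by (simp add: rows_of_border columns_of_border)
  moreover have "length T > 0" using shape by (simp add: ferrers_shape_def)
  ultimately show ?thesis using size unfolding tableau_size_def by linarith
qed

lemma row_iff: "i < length T \<longleftrightarrow> (\<exists>k \<le> n. border T ! k = Row i)"
proof -
  have "i < length T \<longleftrightarrow> Row i \<in> set (filter is_row (border T))"
    by (simp only: rows_of_border) auto
  then show ?thesis by (auto simp: in_set_conv_nth length_border less_Suc_eq_le)
qed

lemma column_iff: "j < length (hd T) \<longleftrightarrow> (\<exists>k \<le> n. border T ! k = Col j)"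
proof -
  have "j < length (hd T) \<longleftrightarrow> Col j \<in> set (filter (\<lambda>x. \<not> is_row x) (border T))"
    by (simp only: columns_of_border) auto
  then show ?thesis by (auto simp: in_set_conv_nth length_border less_Suc_eq_le)
qed

lemma line_before_if_less: "k < l \<Longrightarrow> l \<le> n \<Longrightarrow> line_before T (border T ! k) (border T ! l)"
  using border_sorted by (simp add: sorted_wrt_iff_nth_less length_border)

lemma line_before_irrefl: "\<not> line_before T x x"
  by (cases x) auto

lemma border_inj: "k \<le> n \<Longrightarrow> l \<le> n \<Longrightarrow> border T ! k = border T ! l \<Longrightarrow> k = l"
  using line_before_if_less[of k l] line_before_if_less[of l k]
  by (metis line_before_irrefl linorder_neqE_nat)

lemma label_less_iff:
  assumes "r \<le> n" "c \<le> n" "border T ! r = Row i" "border T ! c = Col j"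
  shows "r < c \<longleftrightarrow> j < length (T ! i)"
proof (cases r c rule: linorder_cases)
  case less
  then show ?thesis using line_before_if_less[of r c] assms by simp
next
  case equal
  then show ?thesis using assms by simp
next
  case greater
  then show ?thesis using line_before_if_less[of c r] assms by simp
qed

lemma cell_iff:
  assumes "r \<le> n" "c \<le> n" "border T ! r = Row i" "border T ! c = Col j"
  shows "(i, j) \<in> cells T \<longleftrightarrow> r < c"
  using label_less_iff[OF assms] row_iff[of i] assms by (auto simp: cells_def)

lemma border_0: "border T ! 0 = Row 0"
proof -
  have "length T > 0" using shape by (simp add: ferrers_shape_def)
  then obtain k where k: "k \<le> n" "border T ! k = Row 0" using row_iff by auto
  show ?thesis
  proof (cases "k = 0")
    case False
    then have "line_before T (border T ! 0) (Row 0)" using k line_before_if_less[of 0 k] by simp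
    then obtain j where j: "border T ! 0 = Col j" "length (T ! 0) \<le> j" by (cases "border T ! 0") auto
    then have "j < length (hd T)" using column_iff by auto
    then show ?thesis using j shape by (simp add: ferrers_shape_def hd_conv_nth)
  qed (use k in simp)
qed

lemma row_0_iff: "r \<le> n \<Longrightarrow> border T ! r = Row 0 \<longleftrightarrow> r = 0"
  using border_0 border_inj[of r 0] by auto

lemma cell_labels:
  assumes "(i, j) \<in> cells T"
  obtains r c where "r \<le> n" "c \<le> n" "r < c" "border T ! r = Row i" "border T ! c = Col j"
proof -
  have i: "i < length T" "j < length (T ! i)" using assms by (auto simp: cells_def)
  then have "length (T ! i) \<le> length (hd T)"
    using row_length_antimono[OF shape, of 0 i] by (auto simp: row_length_def hd_conv_nth split: if_splits)
  then obtain r c where rc: "r \<le> n" "border T ! r = Row i" "c \<le> n" "border T ! c = Col j"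
    using row_iff[of i] column_iff[of j] i by auto
  moreover have "r < c" using cell_iff[OF rc(1,3,2,4)] assms by simp
  ultimately show ?thesis using that by blast
qed

lemma initially_live: "live_cells T {1..n} = {(i, j) \<in> cells T. i \<noteq> 0}"
proof -
  have "\<exists>r \<in> {1..n}. \<exists>c \<in> {1..n}. r < c \<and> border T ! r = Row i \<and> border T ! c = Col j"
    if ij: "(i, j) \<in> cells T" "i \<noteq> 0" for i j
  proof -
    obtain r c where rc: "r \<le> n" "c \<le> n" "r < c" "border T ! r = Row i" "border T ! c = Col j"
      using cell_labels ij(1) by blast
    moreover have "r \<noteq> 0" using row_0_iff[OF rc(1)] rc(4) ij by auto
    ultimately show ?thesis by (intro bexI[of _ r] bexI[of _ c]) auto
  qed
  moreover have "(i, j) \<in> cells T \<and> i \<noteq> 0" if live: "(i, j) \<in> live_cells T {1..n}" for i j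
  proof -
    obtain r c where rc: "r \<in> {1..n}" "c \<in> {1..n}" "r < c" "border T ! r = Row i" "border T ! c = Col j"
      using live by (auto simp: live_cells_def)
    then have "i \<noteq> 0" using row_0_iff[of r] by (cases i) auto
    then show ?thesis using rc cell_iff[of r c i j] by auto
  qed
  ultimately show ?thesis unfolding live_cells_def by blast
qed

end

section \<open>The reading procedure on a tableau\<close>

locale ew = ferrers +
  assumes ew: "ew_tableau T"
begin

abbreviation "R \<equiv> row_labels T"
abbreviation "Z \<equiv> zero_entry T"

lemma row_label_cases:
  assumes "k \<in> {1..n}"
  obtains i where "k \<in> R" "border T ! k = Row i" | j where "k \<notin> R" "border T ! k = Col j"
  using assms size by (cases "border T ! k") (auto simp: row_labels_def)

lemma row_labelD: "k \<in> R \<Longrightarrow> \<exists>i. border T ! k = Row i"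
  by (cases "border T ! k") (auto simp: row_labels_def)

lemma column_labelD: "k \<notin> R \<Longrightarrow> 1 \<le> k \<Longrightarrow> k \<le> n \<Longrightarrow> \<exists>j. border T ! k = Col j"
  using size by (cases "border T ! k") (auto simp: row_labels_def)

lemma entry_eq:
  assumes "r \<le> n" "c \<le> n" "border T ! r = Row i" "border T ! c = Col j" "r < c"
  shows "T ! i ! j = (if Z r c then 0 else 1)"
proof -
  have "(i, j) \<in> cells T" using cell_iff[OF assms(1-4)] assms(5) by simp
  then have "T ! i ! j = 0 \<or> T ! i ! j = 1" using ew by (fastforce simp: ew_tableau_def)
  then show ?thesis using assms(3,4) by (auto simp: zero_entry_def)
qed

lemma no_bad_rectangle_labels: "no_bad_rectangle R Z {1..n}"
  unfolding no_bad_rectangle_def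
proof (intro ballI impI, elim conjE)
  fix r r' c c' assume rc: "r \<in> {1..n} \<inter> R" "r' \<in> {1..n} \<inter> R" "c \<in> {1..n} - R" "c' \<in> {1..n} - R"
    and less: "r < c" "r < c'" "r' < c" "r' < c'" and z: "Z r c" "Z r' c'"
  obtain i i' j j' where l: "border T ! r = Row i" "border T ! r' = Row i'" "border T ! c = Col j" "border T ! c' = Col j'"
    using rc row_labelD[of r] row_labelD[of r'] column_labelD[of c] column_labelD[of c']
    by (simp del: One_nat_def) blast
  have n: "r \<le> n" "r' \<le> n" "c \<le> n" "c' \<le> n" using rc by auto
  show "Z r c' \<or> Z r' c"
  proof (rule ccontr)
    assume nz: "\<not> ?thesis"
    then have "i \<noteq> i'" "j \<noteq> j'" using z l by (auto simp: zero_entry_def)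
    moreover have "(i, j) \<in> cells T" "(i, j') \<in> cells T" "(i', j) \<in> cells T" "(i', j') \<in> cells T"
      using cell_iff[OF n(1,3) l(1,3)] cell_iff[OF n(1,4) l(1,4)]
        cell_iff[OF n(2,3) l(2,3)] cell_iff[OF n(2,4) l(2,4)] less by auto
    moreover have "T ! i ! j = 0" "T ! i' ! j' = 0" "T ! i ! j' = 1" "T ! i' ! j = 1"
      using entry_eq[OF n(1,3) l(1,3)] entry_eq[OF n(1,4) l(1,4)]
        entry_eq[OF n(2,3) l(2,3)] entry_eq[OF n(2,4) l(2,4)] less z nz by auto
    ultimately have "\<exists>i i' j j'. i \<noteq> i' \<and> j \<noteq> j' \<and>
          (i, j) \<in> cells T \<and> (i, j') \<in> cells T \<and> (i', j) \<in> cells T \<and> (i', j') \<in> cells T \<and>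
          T ! i ! j = 0 \<and> T ! i' ! j' = 0 \<and> T ! i ! j' = 1 \<and> T ! i' ! j = 1"
      by (intro exI conjI)
    with ew show False unfolding ew_tableau_def by (elim conjE notE)
  qed
qed

lemma live_cells_delete_columns:
  assumes U: "U \<subseteq> {1..n}" and L: "L \<subseteq> U - R"
  shows "live_cells T U - {(i, j). Col j \<in> (\<lambda>k. border T ! k) ` L} = live_cells T (U - L)"
proof -
  have row: "r \<notin> L" if "border T ! r = Row i" for r i
    using that column_labelD[of r] L U by fastforce
  have col: "Col j \<in> (\<lambda>k. border T ! k) ` L \<longleftrightarrow> c \<in> L" if c: "c \<in> U" "border T ! c = Col j" for c j
  proof
    assume "Col j \<in> (\<lambda>k. border T ! k) ` L"
    then obtain k where k: "k \<in> L" "border T ! k = Col j" by auto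
    moreover have "c = k" using border_inj[of c k] k c subsetD[OF U, of c] subsetD[OF U, of k] L by auto
    ultimately show "c \<in> L" by simp
  next
    assume "c \<in> L"
    then show "Col j \<in> (\<lambda>k. border T ! k) ` L" using c(2) by (metis image_eqI)
  qed
  have "(i, j) \<in> live_cells T U \<and> Col j \<notin> (\<lambda>k. border T ! k) ` L \<longleftrightarrow> (i, j) \<in> live_cells T (U - L)" for i j
    unfolding live_cells_def using row col[of _ j] by blast
  then show ?thesis by auto
qed

lemma live_cells_delete_rows:
  assumes U: "U \<subseteq> {1..n}" and L: "L \<subseteq> U \<inter> R"
  shows "live_cells T U - {(i, j). Row i \<in> (\<lambda>k. border T ! k) ` L} = live_cells T (U - L)"
proof -
  have col: "c \<notin> L" if "border T ! c = Col j" for c j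
    using that row_labelD[of c] L by fastforce
  have row: "Row i \<in> (\<lambda>k. border T ! k) ` L \<longleftrightarrow> r \<in> L" if r: "r \<in> U" "border T ! r = Row i" for r i
  proof
    assume "Row i \<in> (\<lambda>k. border T ! k) ` L"
    then obtain k where k: "k \<in> L" "border T ! k = Row i" by auto
    moreover have "r = k" using border_inj[of r k] k r subsetD[OF U, of r] subsetD[OF U, of k] L by auto
    ultimately show "r \<in> L" by simp
  next
    assume "r \<in> L"
    then show "Row i \<in> (\<lambda>k. border T ! k) ` L" using r(2) by (metis image_eqI)
  qed
  have "(i, j) \<in> live_cells T U \<and> Row i \<notin> (\<lambda>k. border T ! k) ` L \<longleftrightarrow> (i, j) \<in> live_cells T (U - L)" for i j
    unfolding live_cells_def using col row[of _ i] by blast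
  then show ?thesis by auto
qed

lemma read_columns_live:
  assumes U: "U \<subseteq> {1..n}" and L: "L = ready_columns R Z U"
  shows "read_columns T (U, live_cells T U, w) = (U - L, live_cells T (U - L), w @ sorted_list_of_set L)"
proof -
  have le: "k \<le> n" if "k \<in> U" for k using U that by auto
  have "{k \<in> U. \<exists>j. border T ! k = Col j \<and> \<not> (\<exists>i. (i, j) \<in> live_cells T U \<and> T ! i ! j = 1)} = L"
    (is "?L = _")
  proof (rule set_eqI)
    fix k
    show "k \<in> ?L \<longleftrightarrow> k \<in> L"
    proof (cases "k \<in> U")
      case True
      then have "k \<in> {1..n}" using U by auto
      then show ?thesis
      proof (cases rule: row_label_cases)
        case (1 i)
        then show ?thesis by (simp add: L ready_columns_def)
      next
        case (2 j)
        have "(\<exists>i. (i, j) \<in> live_cells T U \<and> T ! i ! j = 1) \<longleftrightarrow> (\<exists>r \<in> U \<inter> R. r < k \<and> \<not> Z r k)"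
        proof
          assume "\<exists>i. (i, j) \<in> live_cells T U \<and> T ! i ! j = 1"
          then obtain i r c where r: "r \<in> U" "c \<in> U" "r < c" "border T ! r = Row i" "border T ! c = Col j" "T ! i ! j = 1"
            by (auto simp: live_cells_def)
          moreover have "c = k" using border_inj[of c k] r le 2 True by auto
          ultimately show "\<exists>r \<in> U \<inter> R. r < k \<and> \<not> Z r k"
            using U size by (intro bexI[of _ r]) (auto simp: zero_entry_def row_labels_def)
        next
          assume "\<exists>r \<in> U \<inter> R. r < k \<and> \<not> Z r k"
          then obtain r where r: "r \<in> U" "r \<in> R" "r < k" "\<not> Z r k" by auto
          obtain i where i: "border T ! r = Row i" using r by (cases "border T ! r") (auto simp: row_labels_def)
          have "T ! i ! j = 1" using entry_eq[OF _ _ i 2(2)] r le True by auto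
          then show "\<exists>i. (i, j) \<in> live_cells T U \<and> T ! i ! j = 1"
            using i r 2 True by (auto simp: live_cells_def)
        qed
        moreover have "k \<in> ?L \<longleftrightarrow> \<not> (\<exists>i. (i, j) \<in> live_cells T U \<and> T ! i ! j = 1)"
          using True 2(2) by simp
        moreover have "k \<in> L \<longleftrightarrow> ready R Z U k" using True 2(1) by (simp add: L ready_columns_def)
        moreover have "ready R Z U k \<longleftrightarrow> \<not> (\<exists>r \<in> U \<inter> R. r < k \<and> \<not> Z r k)"
          using 2(1) unfolding ready_def by simp
        ultimately show ?thesis by simp
      qed
    qed (auto simp: L ready_columns_def)
  qed
  moreover have "live_cells T U - {(i, j). Col j \<in> (\<lambda>k. border T ! k) ` L} = live_cells T (U - L)"
    using L by (intro live_cells_delete_columns[OF U]) (auto simp: ready_columns_def)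
  ultimately show ?thesis by (simp add: read_columns_def Let_def)
qed

lemma read_rows_live:
  assumes U: "U \<subseteq> {1..n}" and L: "L = ready_rows R Z U"
  shows "read_rows T (U, live_cells T U, w) = (U - L, live_cells T (U - L), w @ rev (sorted_list_of_set L))"
proof -
  have le: "k \<le> n" if "k \<in> U" for k using U that by auto
  have "{k \<in> U. \<exists>i. border T ! k = Row i \<and> \<not> (\<exists>j. (i, j) \<in> live_cells T U \<and> T ! i ! j = 0)} = L"
    (is "?L = _")
  proof (rule set_eqI)
    fix k
    show "k \<in> ?L \<longleftrightarrow> k \<in> L"
    proof (cases "k \<in> U")
      case True
      then have "k \<in> {1..n}" using U by auto
      then show ?thesis
      proof (cases rule: row_label_cases)
        case (2 j)
        then show ?thesis by (simp add: L ready_rows_def)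
      next
        case (1 i)
        have "(\<exists>j. (i, j) \<in> live_cells T U \<and> T ! i ! j = 0) \<longleftrightarrow> (\<exists>c \<in> U - R. k < c \<and> Z k c)"
        proof
          assume "\<exists>j. (i, j) \<in> live_cells T U \<and> T ! i ! j = 0"
          then obtain j r c where r: "r \<in> U" "c \<in> U" "r < c" "border T ! r = Row i" "border T ! c = Col j" "T ! i ! j = 0"
            by (auto simp: live_cells_def)
          have "r = k" using border_inj[of r k] r(1,4) le 1(2) True by simp
          moreover have "c \<notin> R" using r(5) by (simp add: row_labels_def)
          moreover have "Z r c" using r(4-6) by (simp add: zero_entry_def)
          ultimately show "\<exists>c \<in> U - R. k < c \<and> Z k c" using r(2,3) by (intro bexI[of _ c]) auto
        next
          assume "\<exists>c \<in> U - R. k < c \<and> Z k c"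
          then obtain c where c: "c \<in> U" "c \<notin> R" "k < c" "Z k c" by auto
          then obtain j where j: "border T ! c = Col j" "T ! i ! j = 0"
            using 1(2) by (auto simp: zero_entry_def)
          have "(i, j) \<in> live_cells T U" unfolding live_cells_def using c j 1(2) True by blast
          then show "\<exists>j. (i, j) \<in> live_cells T U \<and> T ! i ! j = 0" using j by blast
        qed
        moreover have "k \<in> ?L \<longleftrightarrow> \<not> (\<exists>j. (i, j) \<in> live_cells T U \<and> T ! i ! j = 0)"
          using True 1(2) by simp
        moreover have "k \<in> L \<longleftrightarrow> ready R Z U k" using True 1(1) by (simp add: L ready_rows_def)
        moreover have "ready R Z U k \<longleftrightarrow> \<not> (\<exists>c \<in> U - R. k < c \<and> Z k c)"
          using 1(1) unfolding ready_def by simp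
        ultimately show ?thesis by simp
      qed
    qed (auto simp: L ready_rows_def)
  qed
  moreover have "live_cells T U - {(i, j). Row i \<in> (\<lambda>k. border T ! k) ` L} = live_cells T (U - L)"
    using L by (intro live_cells_delete_rows[OF U]) (auto simp: ready_rows_def)
  ultimately show ?thesis by (simp add: read_rows_def Let_def)
qed

lemma no_row_ready_initially: "ready_rows R Z {1..n} = {}"
proof -
  have "\<not> ready R Z {1..n} r" if r: "r \<in> {1..n} \<inter> R" for r
  proof -
    obtain i where i: "border T ! r = Row i" using r row_labelD[of r] by blast
    have "0 < i" using row_0_iff[of r] r i by (cases i) auto
    moreover have "i < length T" using row_iff[of i] i r by auto
    ultimately obtain j where j: "(i, j) \<in> cells T" "T ! i ! j = 0" using ew by (auto simp: ew_tableau_def)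
    then have "(i, j) \<in> live_cells T {1..n}" using initially_live \<open>0 < i\<close> by auto
    then obtain r' c where c: "r' \<in> {1..n}" "c \<in> {1..n}" "r' < c" "border T ! r' = Row i" "border T ! c = Col j"
      by (auto simp: live_cells_def)
    then have "r' = r" using border_inj[of r' r] r i by auto
    moreover have "c \<notin> R" using c by (auto simp: row_labels_def)
    ultimately show ?thesis using c j r by (auto simp: ready_def zero_entry_def)
  qed
  then show ?thesis by (auto simp: ready_rows_def)
qed

text \<open>
  The loop preserves \<^const>\<open>before_columns\<close>; it terminates because the set of columns read in each round
  is nonempty.
\<close>

lemma Psi_progress: "progress R Z {1..n} {} (Psi T)"
proof -
  let ?P = "\<lambda>(U, D, w). D = live_cells T U \<and> before_columns R Z {1..n} U w"
  let ?s = "({1..tableau_size T}, {(i, j) \<in> cells T. i \<noteq> 0}, [])"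
  have "case while (\<lambda>(U, D, w). U \<noteq> {}) (\<lambda>s. read_rows T (read_columns T s)) ?s
    of (U, D, w) \<Rightarrow> U = {} \<and> before_columns R Z {1..n} U w"
  proof (rule while_rule2[where P = ?P and r = "measure (\<lambda>(U, D, w). card U)"])
    have "before_columns R Z {1..n} {1..n} []"
      using no_row_ready_initially
      by (simp add: before_columns_def progress_def legal_word_def rows_at_descents_def)
    then show "?P ?s" by (simp only: size initially_live split)
  next
    fix s assume P: "?P s" and b: "case s of (U, D, w) \<Rightarrow> U \<noteq> {}"
    obtain U w where s: "s = (U, live_cells T U, w)" using P by (cases s) auto
    define L where "L = ready_columns R Z U"
    define L' where "L' = ready_rows R Z (U - L)"
    have U: "U \<noteq> {}" "before_columns R Z {1..n} U w" using P b s by auto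
    then have sub: "U \<subseteq> {1..n}" by (auto simp: before_columns_def progress_def)
    note 1 = before_rows_step[OF U(2) _ no_bad_rectangle_labels U(1) L_def, simplified]
    note 2 = before_columns_step[OF 1(1) _ L'_def, simplified]
    have eq: "read_rows T (read_columns T s) = (U - L - L', live_cells T (U - L - L'),
        (w @ sorted_list_of_set L) @ rev (sorted_list_of_set L'))"
      unfolding s read_columns_live[OF sub L_def] using sub by (subst read_rows_live[OF _ L'_def]) auto
    have "finite U" using sub finite_subset by auto
    moreover have "U - L - L' \<subset> U" using 1(2) by (auto simp: L_def ready_columns_def)
    ultimately have "card (U - L - L') < card U" by (rule psubset_card_mono)
    then show "?P (read_rows T (read_columns T s)) \<and>
        (read_rows T (read_columns T s), s) \<in> measure (\<lambda>(U, D, w). card U)"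
      using 2 unfolding eq by (simp add: s)
  qed auto
  then show ?thesis by (auto simp: Psi_def before_columns_def split: prod.splits)
qed

end

context ew
begin

lemma distinct_Psi: "distinct (Psi T)"
  and set_Psi: "set (Psi T) = {1..n}"
  and legal_Psi: "legal_word R Z {1..n} (Psi T)"
  and rows_at_descents_Psi: "rows_at_descents R (Psi T)"
  using Psi_progress by (auto simp: progress_def)

lemma top_row_entry: "(0, j) \<in> cells T \<Longrightarrow> T ! 0 ! j = 1"
  using ew unfolding ew_tableau_def by (elim conjE) blast

lemma zero_entry_iff_position:
  assumes "r \<in> R" "c \<in> {1..n} - R" "r < c"
  shows "Z r c \<longleftrightarrow> position (Psi T) c < position (Psi T) r"
proof -
  have "r \<in> {1..n} \<inter> R" using assms(1) by (auto simp: row_labels_def size)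
  from legal_word_iff_position[OF distinct_Psi set_Psi, THEN iffD1, OF legal_Psi, rule_format, OF this assms(2,3)]
  show ?thesis .
qed

end

section \<open>Injectivity\<close>

lemma ew_if_EW_tableaux: "T \<in> EW_tableaux n \<Longrightarrow> ew T n"
  by unfold_locales (auto simp: EW_tableaux_def ew_tableau_def)

text \<open>
  The letters of \<open>w\<close> that are smaller than their left neighbour. They turn out to be the row labels.
\<close>

definition descent_bottoms :: "nat list \<Rightarrow> nat set" where
  "descent_bottoms w = {w ! Suc p | p. Suc p < length w \<and> w ! Suc p < w ! p}"

lemma descent_bottoms_if_rows_at_descents:
  assumes "rows_at_descents R w" "R \<subseteq> set w"
  shows "R = descent_bottoms w"
proof
  show "R \<subseteq> descent_bottoms w"
  proof
    fix x assume x: "x \<in> R"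
    then obtain q where q: "q < length w" "w ! q = x" using assms(2) by (meson in_set_conv_nth subsetD)
    have "q \<noteq> 0" using assms(1) x q hd_conv_nth[of w]
      by (intro notI) (auto simp: rows_at_descents_def)
    then obtain p where p: "q = Suc p" by (cases q) auto
    then have "x < w ! p"
      using assms(1) q x successively_nth[of _ w p] by (auto simp: rows_at_descents_def)
    then show "x \<in> descent_bottoms w" using p q by (auto simp: descent_bottoms_def)
  qed
next
  show "descent_bottoms w \<subseteq> R"
    using assms(1) by (auto simp: descent_bottoms_def rows_at_descents_def dest: successively_nth)
qed

lemma (in ew) row_labels_eq: "R = descent_bottoms (Psi T)"
  using rows_at_descents_Psi
  by (rule descent_bottoms_if_rows_at_descents) (auto simp: row_labels_def size set_Psi)

lemma rows_at_descents_descent_bottoms: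
  assumes "distinct w"
  shows "rows_at_descents (descent_bottoms w) w"
proof -
  have "w ! Suc i < w ! i" if "w ! Suc i \<in> descent_bottoms w" "Suc i < length w" for i
    using that assms by (auto simp: descent_bottoms_def nth_eq_iff_index_eq)
  then have "successively (\<lambda>x y. y \<in> descent_bottoms w \<longleftrightarrow> y < x) w"
    by (auto simp: successively_conv_nth) (auto simp: descent_bottoms_def)
  moreover have "hd w \<notin> descent_bottoms w" if "w \<noteq> []"
    using that assms by (auto simp: descent_bottoms_def hd_conv_nth nth_eq_iff_index_eq)
  ultimately show ?thesis by (simp add: rows_at_descents_def)
qed

lemma row_lengths_le_if_same_border:
  assumes "ferrers T n" "ferrers T' n" "border T = border T'" "i < length T" "j < length (T ! i)"
  shows "i < length T' \<and> j < length (T' ! i)"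
proof -
  interpret T: ferrers T n by fact
  interpret T': ferrers T' n by fact
  have "(i, j) \<in> cells T" using assms by (simp add: cells_def)
  then obtain r c where "r \<le> n" "c \<le> n" "r < c" "border T ! r = Row i" "border T ! c = Col j"
    by (rule T.cell_labels)
  then show ?thesis using T'.cell_iff[of r c i j] assms(3) by (auto simp: cells_def)
qed

text \<open>
  The row labels give the shape, through the border. Entries outside the top row are given by
  \<^const>\<open>zero_entry\<close>, and the top row consists of 1s.
\<close>

lemma ew_tableau_determined:
  assumes "ew T n" "ew T' n" and rows: "row_labels T = row_labels T'"
    and entries: "\<And>r c. r \<in> row_labels T \<Longrightarrow> c \<in> {1..n} - row_labels T \<Longrightarrow> r < c \<Longrightarrow>
      zero_entry T r c \<longleftrightarrow> zero_entry T' r c"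
  shows "T = T'"
proof -
  interpret T: ew T n by fact
  interpret T': ew T' n by fact
  have kinds: "map is_row (border T) = map is_row (border T')"
  proof (rule nth_equalityI)
    fix k assume "k < length (map is_row (border T))"
    then have k: "k \<le> n" by (simp add: T.length_border)
    have "is_row (border T ! k) \<longleftrightarrow> is_row (border T' ! k)"
    proof (cases "k = 0")
      case True
      then show ?thesis by (simp add: T.border_0 T'.border_0)
    next
      case False
      then have "k \<in> {1..n}" using k by auto
      moreover have "k \<in> row_labels T \<longleftrightarrow> k \<in> row_labels T'" using rows by simp
      ultimately show ?thesis by (simp add: row_labels_def T.size T'.size)
    qed
    then show "map is_row (border T) ! k = map is_row (border T') ! k"
      using k by (simp add: T.length_border T'.length_border)
  qed (simp add: T.length_border T'.length_border)
  have "length (filter is_row (border T)) = length (filter is_row (border T'))"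
    using arg_cong[OF kinds, of "\<lambda>xs. length (filter id xs)"] by (simp add: filter_map)
  then have len: "length T = length T'" by (simp add: T.rows_of_border T'.rows_of_border)
  have nonempty: "length T > 0" using T.shape by (simp add: ferrers_shape_def)
  have columns: "length (hd T) = length (hd T')"
    using len T.size T'.size nonempty unfolding tableau_size_def by linarith
  have border: "border T = border T'"
    by (rule list_eq_if_same_rows_and_columns[OF kinds])
      (simp_all only: T.rows_of_border T'.rows_of_border T.columns_of_border T'.columns_of_border
        len columns)
  have f: "ferrers T n" "ferrers T' n" by unfold_locales
  show ?thesis
  proof (rule nth_equalityI)
    fix i assume i: "i < length T"
    have lens: "j < length (T ! i) \<longleftrightarrow> j < length (T' ! i)" for j
      using row_lengths_le_if_same_border[OF f border i]
        row_lengths_le_if_same_border[OF f(2,1) border[symmetric], of i] i len by auto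
    show "T ! i = T' ! i"
    proof (rule nth_equalityI)
      show "length (T ! i) = length (T' ! i)" 
        using lens[of "length (T ! i)"] lens[of "length (T' ! i)"] by auto
    next
      fix j assume j: "j < length (T ! i)"
      then have "(i, j) \<in> cells T" using i by (simp add: cells_def)
      then obtain r c where rc: "r \<le> n" "c \<le> n" "r < c" "border T ! r = Row i" "border T ! c = Col j"
        by (rule T.cell_labels)
      show "T ! i ! j = T' ! i ! j"
      proof (cases "r = 0")
        case True
        then have "i = 0" using rc T.border_0 by simp
        then show ?thesis
          using T.top_row_entry[of j] T'.top_row_entry[of j] i j len lens by (simp add: cells_def)
      next
        case False
        have "zero_entry T r c \<longleftrightarrow> zero_entry T' r c"
          using rc False T.size by (intro entries) (auto simp: row_labels_def)
        then show ?thesis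
          using T.entry_eq[OF rc(1,2,4,5,3)] T'.entry_eq[of r c i j] rc border by simp
      qed
    qed
  qed (fact len)
qed

lemma inj_on_Psi: "inj_on Psi (EW_tableaux n)"
proof (rule inj_onI)
  fix T T' assume T: "T \<in> EW_tableaux n" "T' \<in> EW_tableaux n" and eq: "Psi T = Psi T'"
  interpret T: ew T n using T by (intro ew_if_EW_tableaux)
  interpret T': ew T' n using T by (intro ew_if_EW_tableaux)
  have R: "row_labels T = descent_bottoms (Psi T)" "row_labels T' = descent_bottoms (Psi T)"
    by (simp_all only: T.row_labels_eq T'.row_labels_eq eq)
  show "T = T'"
  proof (rule ew_tableau_determined)
    show "ew T n" "ew T' n" by unfold_locales
    show "row_labels T = row_labels T'" using R by simp
    fix r c assume rc: "r \<in> row_labels T" "c \<in> {1..n} - row_labels T" "r < c"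
    then show "zero_entry T r c \<longleftrightarrow> zero_entry T' r c"
      using T.zero_entry_iff_position[OF rc] T'.zero_entry_iff_position[of r c] R by (simp only: eq)
  qed
qed

section \<open>The tableau of a permutation\<close>

definition tableau_entry :: "nat list \<Rightarrow> nat \<Rightarrow> nat \<Rightarrow> nat" where
  "tableau_entry w r c = (if r \<noteq> 0 \<and> position w c < position w r then 0 else 1)"

text \<open>
  The candidate for the preimage of \<open>w\<close>, forced by the analysis of \<^const>\<open>Psi\<close>: the rows are labelled by
  0 and the descent bottoms, the columns by the remaining letters in decreasing order from left to
  right, and row \<open>r\<close> has a cell in exactly the columns \<open>c > r\<close>.
\<close>

definition tableau_of :: "nat list \<Rightarrow> filling" where
  "tableau_of w = map (\<lambda>r. map (tableau_entry w r)
       (takeWhile (\<lambda>c. r < c) (rev (sorted_list_of_set (set w - descent_bottoms w)))))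
     (0 # sorted_list_of_set (descent_bottoms w))"

lemma less_length_takeWhile_iff:
  fixes cs :: "nat list"
  assumes "sorted_wrt (>) cs" "j < length cs"
  shows "j < length (takeWhile (\<lambda>c. r < c) cs) \<longleftrightarrow> r < cs ! j"
proof
  assume j: "j < length (takeWhile (\<lambda>c. r < c) cs)"
  then have "takeWhile (\<lambda>c. r < c) cs ! j \<in> set (takeWhile (\<lambda>c. r < c) cs)" by (rule nth_mem)
  then show "r < cs ! j" using takeWhile_nth[OF j] by (metis set_takeWhileD)
next
  assume r: "r < cs ! j"
  show "j < length (takeWhile (\<lambda>c. r < c) cs)" (is "_ < ?k")
  proof (rule ccontr)
    assume "\<not> ?thesis"
    then have k: "?k \<le> j" by simp
    then have "\<not> r < cs ! ?k" using assms(2) by (intro nth_length_takeWhile) simp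
    moreover have "cs ! j \<le> cs ! ?k"
      using k assms by (cases "?k = j") (auto dest: sorted_wrt_nth_less[of _ _ ?k j])
    ultimately show False using r by simp
  qed
qed

locale permutation_word =
  fixes w :: "nat list" and n :: nat
  assumes distinct: "distinct w" and set: "set w = {1..n}" and pos: "n \<ge> 1"
begin

abbreviation "D \<equiv> descent_bottoms w"
abbreviation "T \<equiv> tableau_of w"
definition "rs = 0 # sorted_list_of_set D"
definition "cs = rev (sorted_list_of_set ({1..n} - D))"

lemma descent_bottom_less: "r \<in> D \<Longrightarrow> \<exists>x \<in> {1..n}. r < x"
  using set nth_mem[of _ w] by (fastforce simp: descent_bottoms_def)

lemma D_subset: "D \<subseteq> {1..n}"
  using set nth_mem[of _ w] by (fastforce simp: descent_bottoms_def)

lemma finite_D: "finite D"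
  using D_subset finite_subset by blast

lemma rs: "sorted_wrt (<) rs" "set rs = insert 0 D" "rs ! 0 = 0" "rs \<noteq> []"
  using finite_D D_subset by (auto simp: rs_def)

lemma cs: "sorted_wrt (>) cs" "set cs = {1..n} - D"
  by (auto simp: cs_def sorted_wrt_rev)

lemma length_T: "length T = length rs"
  by (simp add: tableau_of_def rs_def)

lemma row_T: "i < length rs \<Longrightarrow> T ! i = map (tableau_entry w (rs ! i)) (takeWhile (\<lambda>c. rs ! i < c) cs)"
  unfolding tableau_of_def rs_def cs_def set by (rule nth_map)

lemma less_length_row_iff:
  assumes "i < length rs"
  shows "j < length (T ! i) \<longleftrightarrow> j < length cs \<and> rs ! i < cs ! j"
  using less_length_takeWhile_iff[OF cs(1), of j "rs ! i"] length_takeWhile_le[of "\<lambda>c. rs ! i < c" cs]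
  by (auto simp: row_T[OF assms])

lemma cells_T: "(i, j) \<in> cells T \<longleftrightarrow> i < length rs \<and> j < length cs \<and> rs ! i < cs ! j"
  using less_length_row_iff by (auto simp: cells_def length_T)

lemma entry_T: "(i, j) \<in> cells T \<Longrightarrow> T ! i ! j = tableau_entry w (rs ! i) (cs ! j)"
  by (auto simp: cells_def length_T row_T takeWhile_nth)

lemma top_row: "length (hd T) = length cs"
proof -
  have "T \<noteq> []" using length_T rs(4) by auto
  then have "hd T = T ! 0" by (rule hd_conv_nth)
  moreover have "takeWhile (\<lambda>c. rs ! 0 < c) cs = cs" using cs(2) rs(3) by auto
  moreover have "T ! 0 = map (tableau_entry w (rs ! 0)) (takeWhile (\<lambda>c. rs ! 0 < c) cs)"
    using rs(4) by (intro row_T) simp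
  ultimately show ?thesis by (metis length_map)
qed

text \<open>
  The letter \<open>n\<close> is no descent bottom, so it labels a column, and every row has a cell in that column.
\<close>

lemma ferrers_T: "ferrers T n"
proof
  have "length (T ! i) > 0" if i: "i < length rs" for i
  proof -
    have "rs ! i \<in> insert 0 D" using nth_mem[OF i] rs(2) by simp
    then have "rs ! i < n" using descent_bottom_less[of "rs ! i"] pos by auto
    moreover have "n \<in> set cs" using cs(2) pos descent_bottom_less[of n] by auto
    then obtain j where "j < length cs" "cs ! j = n" by (auto simp: in_set_conv_nth)
    ultimately have "j < length (T ! i)" using less_length_row_iff[OF i] by simp
    then show ?thesis by linarith
  qed
  moreover have "length (T ! i') \<le> length (T ! i)" if i: "i < i'" "i' < length rs" for i i'
  proof (rule ccontr)
    assume "\<not> ?thesis"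
    then have "length (T ! i) < length cs \<and> rs ! i' < cs ! length (T ! i)"
      using less_length_row_iff[OF i(2), of "length (T ! i)"] by simp
    moreover have "rs ! i < rs ! i'" using sorted_wrt_nth_less[OF rs(1) i] .
    ultimately show False using less_length_row_iff[of i "length (T ! i)"] i by simp
  qed
  ultimately show "ferrers_shape T"
    using length_T rs(4) by (fastforce simp: ferrers_shape_def sorted_wrt_iff_nth_less in_set_conv_nth)
  have "card ({1..n} - D) = n - card D" "card D \<le> n"
    using card_Diff_subset[OF finite_D D_subset] card_mono[OF _ D_subset] by auto
  then show "tableau_size T = n"
    by (simp add: tableau_size_def top_row length_T) (simp add: rs_def cs_def)
qed

sublocale ferrers T n by (rule ferrers_T)

fun line_label :: "line \<Rightarrow> nat" where
  "line_label (Row i) = rs ! i"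
| "line_label (Col j) = cs ! j"

text \<open>
  The list of line labels along the border is strictly increasing with set \<open>{0..n}\<close>, so it is
  \<open>[0..<Suc n]\<close>: the labels used to build the tableau are its border labels.
\<close>

lemma line_label_border: "k \<le> n \<Longrightarrow> line_label (border T ! k) = k"
proof -
  have lines: "set (border T) = Row ` {..<length rs} \<union> Col ` {..<length cs}"
    by (simp only: set_border length_T top_row)
  have mono: "line_label x < line_label y"
    if xy: "x \<in> set (border T)" "y \<in> set (border T)" "line_before T x y" for x y
  proof (cases x; cases y)
    fix i i' assume "x = Row i" "y = Row i'"
    then show ?thesis using xy lines sorted_wrt_nth_less[OF rs(1), of i i'] by auto
  next
    fix i j assume "x = Row i" "y = Col j"
    then show ?thesis using xy lines less_length_row_iff[of i j] by auto
  next
    fix i j assume l: "x = Col j" "y = Row i"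
    then have ij: "i < length rs" "j < length cs" using xy lines by auto
    then have "cs ! j \<le> rs ! i" using xy l less_length_row_iff[of i j] by auto
    moreover have "rs ! i \<in> insert 0 D" "cs ! j \<in> {1..n} - D"
      using nth_mem[OF ij(1)] nth_mem[OF ij(2)] rs(2) cs(2) by auto
    then have "cs ! j \<noteq> rs ! i" by auto
    ultimately show ?thesis using l by simp
  next
    fix j j' assume "x = Col j" "y = Col j'"
    then show ?thesis using xy lines sorted_wrt_nth_less[OF cs(1), of j' j] by auto
  qed
  have "sorted_wrt (<) (map line_label (border T))"
    using border_sorted mono by (rule sorted_wrt_map_mono)
  moreover have "set (map line_label (border T)) = {0..<Suc n}"
  proof -
    have "line_label ` set (border T) = set rs \<union> set cs"
    proof -
      have "(\<lambda>i. xs ! i) ` {..<length xs} = set xs" for xs :: "nat list"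
        by (auto simp: set_conv_nth)
      then show ?thesis by (simp only: lines image_Un image_image line_label.simps)
    qed
    also have "\<dots> = {0..<Suc n}" using rs(2) cs(2) D_subset by auto
    finally show ?thesis by (simp only: set_map)
  qed
  ultimately have "map line_label (border T) = [0..<Suc n]"
    by (intro strict_sorted_equal) (simp_all only: sorted_wrt_upt set_upt)
  then show "line_label (border T ! k) = k" if "k \<le> n"
    using that nth_map[of k "border T" line_label] by (simp add: length_border del: upt_Suc)
qed

lemma border_RowD: "k \<le> n \<Longrightarrow> border T ! k = Row i \<Longrightarrow> rs ! i = k"
  and border_ColD: "k \<le> n \<Longrightarrow> border T ! k = Col j \<Longrightarrow> cs ! j = k"
  using line_label_border[of k] by auto

lemma row_labels_T: "row_labels T = D"
proof -
  have "is_row (border T ! k) \<longleftrightarrow> k \<in> D" if k: "k \<in> {1..n}" for k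
  proof (cases "border T ! k")
    case (Row i)
    then have "rs ! i = k" "i < length rs" using k border_RowD row_iff[of i] by (auto simp: length_T)
    then have "k \<in> insert 0 D" using rs(2) nth_mem by metis
    then show ?thesis using Row k by auto
  next
    case (Col j)
    then have "cs ! j = k" "j < length cs" using k border_ColD column_iff[of j] by (auto simp: top_row)
    then have "k \<notin> D" using cs(2) nth_mem by (metis DiffD2)
    then show ?thesis using Col by simp
  qed
  then show ?thesis using D_subset by (auto simp: row_labels_def size)
qed

lemma zero_entry_T:
  assumes "r \<in> D" "c \<in> {1..n} - D" "r < c"
  shows "zero_entry T r c \<longleftrightarrow> position w c < position w r"
proof -
  have rc: "r \<in> {1..n}" "c \<in> {1..n}" using assms D_subset by auto
  obtain i where i: "border T ! r = Row i"
    using assms(1) by (cases "border T ! r") (auto simp flip: row_labels_T simp: row_labels_def)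
  obtain j where j: "border T ! c = Col j"
    using assms(2) by (cases "border T ! c") (auto simp flip: row_labels_T simp: row_labels_def size)
  have "(i, j) \<in> cells T" using cell_iff[OF _ _ i j] rc assms by auto
  then have "T ! i ! j = tableau_entry w r c"
    using entry_T border_RowD[OF _ i] border_ColD[OF _ j] rc by auto
  then show ?thesis using i j rc by (auto simp: zero_entry_def tableau_entry_def)
qed

text \<open>
  Since the first letter of \<open>w\<close> is a column, the decreasing run of rows that ends in \<open>r\<close> is preceded by
  a column, which is larger than \<open>r\<close>. It provides the 0 that row \<open>r\<close> needs.
\<close>

lemma larger_column_earlier:
  assumes "r \<in> D"
  obtains c where "c \<in> {1..n} - D" "r < c" "position w c < position w r"
proof -
  have rw: "r \<in> set w" using assms D_subset set by auto
  obtain as bs where w: "w = as @ r # bs" using split_list[OF rw] by blast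
  have d: "rows_at_descents D w" using distinct by (rule rows_at_descents_descent_bottoms)
  have "as \<noteq> []" using d assms unfolding rows_at_descents_def w by auto
  then obtain y as' where as: "as = y # as'" by (cases as) auto
  have y: "y \<notin> D" using d unfolding rows_at_descents_def w as by auto
  have "successively (\<lambda>x y. y \<in> D \<longleftrightarrow> y < x) ((y # as' @ [r]) @ bs)"
    using d unfolding rows_at_descents_def w as by auto
  then have "successively (\<lambda>x y. y \<in> D \<longleftrightarrow> y < x) (y # as' @ [r])"
    unfolding successively_append_iff by blast
  from row_after_larger_column[OF this assms] y obtain c where c: "c \<in> set as - D" "r < c"
    unfolding as by blast
  have "distinct (as @ r # bs)" using distinct w by simp
  from position_less_iff[OF this, of c] c have "position w c < position w r" unfolding w by simp
  moreover have "c \<in> {1..n}" using c w set by auto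
  ultimately show ?thesis using c that by blast
qed

lemma ew_tableau_T: "ew_tableau T"
  unfolding ew_tableau_def
proof (intro conjI)
  show "ferrers_shape T" by (rule shape)
  show "\<forall>(i, j) \<in> cells T. T ! i ! j \<in> {0, 1}"
  proof (rule ballI)
    fix x assume x: "x \<in> cells T"
    obtain i j where ij: "x = (i, j)" by (cases x)
    show "case x of (i, j) \<Rightarrow> T ! i ! j \<in> {0, 1}"
      using entry_T[of i j] x by (simp add: ij tableau_entry_def)
  qed
  show "\<forall>j. (0, j) \<in> cells T \<longrightarrow> T ! 0 ! j = 1"
  proof (intro allI impI)
    fix j assume "(0, j) \<in> cells T"
    from entry_T[OF this] show "T ! 0 ! j = 1" by (simp add: rs(3) tableau_entry_def)
  qed
  show "\<forall>i. 0 < i \<and> i < length T \<longrightarrow> (\<exists>j. (i, j) \<in> cells T \<and> T ! i ! j = 0)"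
  proof (intro allI impI, elim conjE)
    fix i assume i: "0 < i" "i < length T"
    then have i': "i < length rs" by (simp add: length_T)
    have "rs ! i > 0" using sorted_wrt_nth_less[OF rs(1) i(1) i'] rs(3) by simp
    moreover have "rs ! i \<in> insert 0 D" using nth_mem[OF i'] rs(2) by simp
    ultimately have "rs ! i \<in> D" by auto
    then obtain c where c: "c \<in> {1..n} - D" "rs ! i < c" "position w c < position w (rs ! i)"
      by (rule larger_column_earlier)
    obtain j where j: "j < length cs" "cs ! j = c" using c(1) cs(2) by (metis in_set_conv_nth)
    have cell: "(i, j) \<in> cells T" using cells_T i' j c(2) by simp
    moreover have "T ! i ! j = 0"
      using entry_T[OF cell] j c(3) \<open>rs ! i > 0\<close> by (simp add: tableau_entry_def)
    ultimately show "\<exists>j. (i, j) \<in> cells T \<and> T ! i ! j = 0" by blast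
  qed
  show "\<not> (\<exists>i i' j j'. i \<noteq> i' \<and> j \<noteq> j' \<and>
          (i, j) \<in> cells T \<and> (i, j') \<in> cells T \<and> (i', j) \<in> cells T \<and> (i', j') \<in> cells T \<and>
          T ! i ! j = 0 \<and> T ! i' ! j' = 0 \<and> T ! i ! j' = 1 \<and> T ! i' ! j = 1)"
  proof (intro notI, elim exE conjE)
    fix i i' j j'
    assume c: "(i, j) \<in> cells T" "(i, j') \<in> cells T" "(i', j) \<in> cells T" "(i', j') \<in> cells T"
      and e: "T ! i ! j = 0" "T ! i' ! j' = 0" "T ! i ! j' = 1" "T ! i' ! j = 1"
    have zero: "r \<noteq> 0 \<and> position w c < position w r" if "tableau_entry w r c = 0" for r c
      using that by (simp add: tableau_entry_def split: if_splits)
    have one: "r = 0 \<or> position w r \<le> position w c" if "tableau_entry w r c = 1" for r c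
      using that by (simp add: tableau_entry_def not_less split: if_splits)
    have "rs ! i \<noteq> 0 \<and> position w (cs ! j) < position w (rs ! i)"
      by (rule zero) (simp only: e(1) entry_T[OF c(1), symmetric])
    moreover have "rs ! i' \<noteq> 0 \<and> position w (cs ! j') < position w (rs ! i')"
      by (rule zero) (simp only: e(2) entry_T[OF c(4), symmetric])
    moreover have "rs ! i = 0 \<or> position w (rs ! i) \<le> position w (cs ! j')"
      by (rule one) (simp only: e(3) entry_T[OF c(2), symmetric])
    moreover have "rs ! i' = 0 \<or> position w (rs ! i') \<le> position w (cs ! j)"
      by (rule one) (simp only: e(4) entry_T[OF c(3), symmetric])
    \<comment> \<open>Around the rectangle the four entries give a cyclic chain of inequalities between the
      positions of the two rows and the two columns.\<close>
    ultimately show False by (meson leD le_less_trans less_le_trans less_trans)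
  qed
qed

lemma tableau_of_EW: "T \<in> EW_tableaux n"
  using ew_tableau_T size by (simp add: EW_tableaux_def)

sublocale ew T n by (rule ew_if_EW_tableaux) (rule tableau_of_EW)

text \<open>
  No need to follow the procedure on the tableau: both \<open>w\<close> and the output are legal words for the
  same rows and entries with rows exactly at the descents, and such a word is unique.
\<close>

lemma Psi_tableau_of: "Psi T = w"
proof (rule legal_word_unique)
  show "legal_word D (zero_entry T) {1..n} (Psi T)" "rows_at_descents D (Psi T)"
    using legal_Psi rows_at_descents_Psi unfolding row_labels_T by auto
  show "legal_word D (zero_entry T) {1..n} w"
    using zero_entry_T by (subst legal_word_iff_position[OF distinct set]) auto
  show "rows_at_descents D w" using distinct by (rule rows_at_descents_descent_bottoms)
qed (use distinct set distinct_Psi set_Psi in auto)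

end

theorem proposition2p6:
  fixes n :: nat
  assumes "n \<ge> 1"
  shows "bij_betw Psi (EW_tableaux n) (permutations_of_set {1..n})"
  unfolding bij_betw_def
proof (intro conjI equalityI subsetI)
  show "inj_on Psi (EW_tableaux n)" by (rule inj_on_Psi)
next
  fix w assume "w \<in> Psi ` EW_tableaux n"
  then obtain T where T: "T \<in> EW_tableaux n" "w = Psi T" by blast
  interpret ew T n using T(1) by (rule ew_if_EW_tableaux)
  show "w \<in> permutations_of_set {1..n}"
    using distinct_Psi set_Psi by (simp add: T(2) permutations_of_set_def)
next
  fix w assume "w \<in> permutations_of_set {1..n}"
  then interpret permutation_word w n
    using assms by unfold_locales (auto simp: permutations_of_set_def)
  show "w \<in> Psi ` EW_tableaux n" using Psi_tableau_of tableau_of_EW by (metis image_eqI)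
qed

end
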